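(* Consider any execution of the Heterogeneous Paxos protocol, with a condensed and valid learner graph. For all learners $a,b$ and all sets of messages $q_a,q_b$ of the execution: if $\mathrm{Entangled}(a,b)$, $\mathrm{Decision}_a(q_a)$ and $\mathrm{Decision}_b(q_b)$, then $\mathrm{V}(q_a)=\mathrm{V}(q_b)$.
   Context: Setting. There are fixed finite sets of acceptors, proposers (including the acceptors) and learners. In an execution, $\mathcal S$ denotes the (unknown, predetermined) set of acceptors that are actually safe; the other acceptors may be Byzantine and behave arbitrarily. A learner graph assigns to each learner $a$ a set $Q_a$ of sets of acceptors (quorums) and to each pair of learners $a,b$ (possibly equal) a set $a\!-\!b=b\!-\!a$ of sets of acceptors (safe sets). All $Q_a$ and $a\!-\!b$ are closed under supersets. The graph is condensed: $(a\!-\!b)\cap(b\!-\!c)\subseteq a\!-\!c$ for all $a,b,c$. It is valid: for all $a,b$, if $s\in a\!-\!b$, $q\in Q_a$, $q'\in Q_b$, then $q\cap q'\cap s\ne\emptyset$. $\mathrm{Entangled}(a,b)$ means $\mathcal S\in a\!-\!b$. Messages. Each message $x$ has an unforgeable signer $\mathrm{Sig}(x)$, a finite set $x.\mathit{refs}$ of referenced messages (by collision-resistant hash, so the reference graph is acyclic), and a type $1a$, $1b$ or $2a$. A $1a$ message $y$ carries $y.\mathit{value}$ and a natural number $y.\mathit{ballot}$; a $2a$ message $x$ carries a learner $x.\mathit{lrn}$. Distinct $1a$ messages have distinct ballots. Definitions (for messages $x,y,m,z$). - $\mathrm{Sig}(X)=\{\mathrm{Sig}(m):m\in X\}$ for a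 set $X$ of messages; $\mathrm{Tran}(x)=\{x\}\cup\bigcup_{m\in x.\mathit{refs}}\mathrm{Tran}(m)$. - $\mathrm{Get1a}(x)$: the $1a$ message in $\mathrm{Tran}(x)$ with largest ballot (every message considered has at least one). $\mathrm{b}(x)=\mathrm{Get1a}(x).\mathit{ballot}$, $\mathrm{V}(x)=\mathrm{Get1a}(x).\mathit{value}$. - $\mathrm{Caught}(x)=\{\mathrm{Sig}(m) : \exists m',\ \{m,m'\}\subseteq\mathrm{Tran}(x),\ \mathrm{Sig}(m)=\mathrm{Sig}(m'),\ m\notin\mathrm{Tran}(m'),\ m'\notin\mathrm{Tran}(m)\}$. - $\mathrm{Con}_a(x)=\{b : \exists s\in a\!-\!b,\ s\cap\mathrm{Caught}(x)=\emptyset\}$. - For $x$ of type $2a$: $\mathrm{Buried}(x,y)$ iff the set of all $\mathrm{Sig}(m)$ such that $m\in\mathrm{Tran}(y)$ and there is a $2a$ message $z$ with $\{x,z\}\subseteq\mathrm{Tran}(m)$, $\mathrm{V}(z)\ne\mathrm{V}(x)$, $\mathrm{b}(z)>\mathrm{b}(x)$, $z.\mathit{lrn}=x.\mathit{lrn}$, belongs to $Q_{x.\mathit{lrn}}$. - $\mathrm{Con2as}_a(x)$: the set of $2a$ messages $m\in\mathrm{Tran}(x)$ with $\mathrm{Sig}(m)=\mathrm{Sig}(x)$, not $\mathrm{Buried}(m,x)$, and $m.\mathit{lrn}\in\mathrm{Con}_a(x)$. - For $x$ of type $1b$: $\mathrm{fresh}_a(x)$ iff $\mathrm{V}(x)=\mathrm{V}(m)$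 for all $m\in\mathrm{Con2as}_a(x)$. - For $x$ of type $2a$: $\mathrm{q}(x)$ is the set of $1b$ messages $m\in\mathrm{Tran}(x)$ with $\mathrm{fresh}_{x.\mathit{lrn}}(m)$ and $\mathrm{b}(m)=\mathrm{b}(x)$. - Well-formedness (assumed of all messages considered; ill-formed messages are ignored): if $x$ is a $1b$, $y\in\mathrm{Tran}(x)$, $y\neq x$ and $y\ne\mathrm{Get1a}(x)$, then $\mathrm{b}(y)\ne\mathrm{b}(x)$; if $z$ is a $2a$, then $\mathrm{Sig}(\mathrm{q}(z))\in Q_{z.\mathit{lrn}}$ and $\mathrm{Sig}(z)\in\mathrm{Sig}(\mathrm{q}(z))$. - $\mathrm{Decision}_a(q_a)$ iff $\mathrm{Sig}(q_a)\in Q_a$, every $x\in q_a$ is a $2a$ with $x.\mathit{lrn}=a$, and $\mathrm{b}(x)=\mathrm{b}(y)$ for all $x,y\in q_a$; then $\mathrm{b}(q_a)$ and $\mathrm{V}(q_a)$ denote the common ballot and value of the messages in $q_a$. Protocol. Each safe acceptor keeps sets known and recent, initially empty. It delays receipt of a message until all messages it references are known. On receipt of a message $m$ not in known it atomically: forwards $m$ to all acceptors and learners; adds $m$ to known and recent; if $m$ is a $1a$ with ballot higher than any seen before, creates a $1b$ message $z$ with $z.\mathit{refs}=$ recent, empties recent, and receives (processes and forwards) $z$ itself immediately; if $m$ is a $1b$ with $\mathrm{b}(m)=\max_{x\in\text{known}}\mathrm{b}(x)$, then for each learner $\ell$ it forms a $2a$ message $z$ with $z.\mathit{refs}=$ recent,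 $z.\mathit{lrn}=\ell$, and if $z$ is well-formed, empties recent and receives $z$ itself immediately. Safe acceptors send no other messages. In particular every message sent by a safe acceptor transitively references every message it previously sent or received. A learner $a$ decides $\mathrm{V}(q_a)$ when it has received a set $q_a$ of messages with $\mathrm{Decision}_a(q_a)$. *)

theory Defs
  imports Main "HOL-Library.FSet"
begin

section \<open>Participants and learner graph\<close>

record ('p, 'l) system =
  acceptors :: "'p set"
  proposers :: "'p set"
  learners  :: "'l set"
  quorums   :: "'l \<Rightarrow> 'p set set"
  safe_sets :: "'l \<Rightarrow> 'l \<Rightarrow> 'p set set"

definition learner_graph :: "('p, 'l) system \<Rightarrow> bool" where
  "learner_graph G \<longleftrightarrow>
     finite (acceptors G) \<and> finite (proposers G) \<and> finite (learners G) \<and>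
     acceptors G \<subseteq> proposers G \<and>
     (\<forall>a\<in>learners G. quorums G a \<subseteq> Pow (acceptors G) \<and>
        (\<forall>q q'. q \<in> quorums G a \<and> q \<subseteq> q' \<and> q' \<subseteq> acceptors G \<longrightarrow> q' \<in> quorums G a)) \<and>
     (\<forall>a\<in>learners G. \<forall>b\<in>learners G.
        safe_sets G a b = safe_sets G b a \<and>
        safe_sets G a b \<subseteq> Pow (acceptors G) \<and>
        (\<forall>s s'. s \<in> safe_sets G a b \<and> s \<subseteq> s' \<and> s' \<subseteq> acceptors G \<longrightarrow> s' \<in> safe_sets G a b))"

definition condensed :: "('p, 'l) system \<Rightarrow> bool" where
  "condensed G \<longleftrightarrow>
     (\<forall>a\<in>learners G. \<forall>b\<in>learners G. \<forall>c\<in>learners G.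
        safe_sets G a b \<inter> safe_sets G b c \<subseteq> safe_sets G a c)"

definition valid :: "('p, 'l) system \<Rightarrow> bool" where
  "valid G \<longleftrightarrow>
     (\<forall>a\<in>learners G. \<forall>b\<in>learners G.
        \<forall>s\<in>safe_sets G a b. \<forall>q\<in>quorums G a. \<forall>q'\<in>quorums G b. q \<inter> q' \<inter> s \<noteq> {})"

definition Entangled :: "('p, 'l) system \<Rightarrow> 'p set \<Rightarrow> 'l \<Rightarrow> 'l \<Rightarrow> bool" where
  "Entangled G S a b \<longleftrightarrow> S \<in> safe_sets G a b"

section \<open>Messages\<close>

text \<open>Referencing by collision-resistant hash is modelled by letting a message contain the finite
  set of the messages it references. Hence the reference graph is acyclic, and messages with the
  same content are equal. The field \<open>Sig\<close> is only data: unforgeability is a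
  property of executions (see \<open>env_step\<close> below).\<close>

datatype ('p, 'l, 'v) msg =
    is_1a: M1a (Sig: 'p) (refs: "('p, 'l, 'v) msg fset") ("value": 'v) (ballot: nat)
  | is_1b: M1b (Sig: 'p) (refs: "('p, 'l, 'v) msg fset")
  | is_2a: M2a (Sig: 'p) (refs: "('p, 'l, 'v) msg fset") (lrn: 'l)

lemma size_refs: "m |\<in>| refs x \<Longrightarrow> size m < size x"
  by (cases x) (auto simp: size_fset_simps less_Suc_eq_le
      intro!: order.trans[OF _ member_le_sum[of m, OF _ _ finite_fset]] trans_le_add1)

function Tran :: "('p, 'l, 'v) msg \<Rightarrow> ('p, 'l, 'v) msg set" where
  "Tran x = {x} \<union> (\<Union>m\<in>fset (refs x). Tran m)"
  by auto
termination
  by (relation "measure size") (auto intro: size_refs)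

declare Tran.simps [simp del]

text \<open>The maximum exists if \<open>Tran x\<close> contains a 1a message, and it is unique because ballots
  of distinct 1a messages of an execution are distinct; both are ensured by \<open>env_step\<close>.\<close>

definition Get1a :: "('p, 'l, 'v) msg \<Rightarrow> ('p, 'l, 'v) msg" where
  "Get1a x = (ARG_MAX ballot m. m \<in> Tran x \<and> is_1a m)"

definition bal :: "('p, 'l, 'v) msg \<Rightarrow> nat" where
  "bal x = ballot (Get1a x)"

definition val :: "('p, 'l, 'v) msg \<Rightarrow> 'v" where
  "val x = value (Get1a x)"

definition Caught :: "('p, 'l, 'v) msg \<Rightarrow> 'p set" where
  "Caught x = {Sig m | m. \<exists>m'. {m, m'} \<subseteq> Tran x \<and> Sig m = Sig m' \<and> m \<notin> Tran m' \<and> m' \<notin> Tran m}"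

definition Con :: "('p, 'l) system \<Rightarrow> 'l \<Rightarrow> ('p, 'l, 'v) msg \<Rightarrow> 'l set" where
  "Con G a x = {b \<in> learners G. \<exists>s\<in>safe_sets G a b. s \<inter> Caught x = {}}"

definition Buried :: "('p, 'l) system \<Rightarrow> ('p, 'l, 'v) msg \<Rightarrow> ('p, 'l, 'v) msg \<Rightarrow> bool" where
  "Buried G x y \<longleftrightarrow>
     {Sig m | m. m \<in> Tran y \<and>
        (\<exists>z. is_2a z \<and> {x, z} \<subseteq> Tran m \<and> val z \<noteq> val x \<and> bal z > bal x \<and> lrn z = lrn x)}
     \<in> quorums G (lrn x)"

definition Con2as :: "('p, 'l) system \<Rightarrow> 'l \<Rightarrow> ('p, 'l, 'v) msg \<Rightarrow> ('p, 'l, 'v) msg set" where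
  "Con2as G a x =
     {m \<in> Tran x. is_2a m \<and> Sig m = Sig x \<and> \<not> Buried G m x \<and> lrn m \<in> Con G a x}"

definition fresh :: "('p, 'l) system \<Rightarrow> 'l \<Rightarrow> ('p, 'l, 'v) msg \<Rightarrow> bool" where
  "fresh G a x \<longleftrightarrow> (\<forall>m\<in>Con2as G a x. val x = val m)"

definition q :: "('p, 'l) system \<Rightarrow> ('p, 'l, 'v) msg \<Rightarrow> ('p, 'l, 'v) msg set" where
  "q G x = {m \<in> Tran x. is_1b m \<and> fresh G (lrn x) m \<and> bal m = bal x}"

definition well_formed :: "('p, 'l) system \<Rightarrow> ('p, 'l, 'v) msg \<Rightarrow> bool" where
  "well_formed G x \<longleftrightarrow>
     (is_1b x \<longrightarrow> (\<forall>y\<in>Tran x. y \<noteq> x \<and> y \<noteq> Get1a x \<longrightarrow> bal y \<noteq> bal x)) \<and>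
     (is_2a x \<longrightarrow> Sig ` q G x \<in> quorums G (lrn x) \<and> Sig x \<in> Sig ` q G x)"

definition Decision :: "('p, 'l) system \<Rightarrow> 'l \<Rightarrow> ('p, 'l, 'v) msg set \<Rightarrow> bool" where
  "Decision G a X \<longleftrightarrow>
     Sig ` X \<in> quorums G a \<and> (\<forall>x\<in>X. is_2a x \<and> lrn x = a) \<and> (\<forall>x\<in>X. \<forall>y\<in>X. bal x = bal y)"

definition common_val :: "('p, 'l, 'v) msg set \<Rightarrow> 'v" where
  "common_val X = (THE v. \<forall>x\<in>X. val x = v)"

section \<open>Safe acceptors\<close>

record ('p, 'l, 'v) acceptor_state =
  known  :: "('p, 'l, 'v) msg fset"
  recent :: "('p, 'l, 'v) msg fset"

definition add_msg ::
  "('p, 'l, 'v) msg \<Rightarrow> ('p, 'l, 'v) acceptor_state \<Rightarrow> ('p, 'l, 'v) acceptor_state" where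
  "add_msg m s = s\<lparr>known := finsert m (known s), recent := finsert m (recent s)\<rparr>"

definition receive_2a ::
  "('p, 'l, 'v) msg \<Rightarrow> ('p, 'l, 'v) acceptor_state \<Rightarrow> ('p, 'l, 'v) acceptor_state" where
  "receive_2a m s = (if m |\<in>| known s then s else add_msg m s)"

definition form_2a ::
  "('p, 'l) system \<Rightarrow> 'p \<Rightarrow> 'l \<Rightarrow> ('p, 'l, 'v) acceptor_state \<Rightarrow> ('p, 'l, 'v) acceptor_state" where
  "form_2a G p l s =
     (let z = M2a p (recent s) l
      in if well_formed G z then receive_2a z (s\<lparr>recent := {||}\<rparr>) else s)"

text \<open>The list \<open>ls\<close> is the order in which acceptor \<open>p\<close> runs through the learners.\<close>

definition receive_1b ::
  "('p, 'l) system \<Rightarrow> 'p \<Rightarrow> 'l list \<Rightarrow> ('p, 'l, 'v) msg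
     \<Rightarrow> ('p, 'l, 'v) acceptor_state \<Rightarrow> ('p, 'l, 'v) acceptor_state" where
  "receive_1b G p ls m s =
     (if m |\<in>| known s then s
      else let s' = add_msg m s
           in if bal m = Max (bal ` fset (known s')) then fold (form_2a G p) ls s' else s')"

definition receive_1a ::
  "('p, 'l) system \<Rightarrow> 'p \<Rightarrow> 'l list \<Rightarrow> ('p, 'l, 'v) msg
     \<Rightarrow> ('p, 'l, 'v) acceptor_state \<Rightarrow> ('p, 'l, 'v) acceptor_state" where
  "receive_1a G p ls m s =
     (if m |\<in>| known s then s
      else let s' = add_msg m s
           in if \<forall>y\<in>fset (known s). is_1a y \<longrightarrow> ballot y < ballot m
              then receive_1b G p ls (M1b p (recent s')) (s'\<lparr>recent := {||}\<rparr>)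
              else s')"

definition receive ::
  "('p, 'l) system \<Rightarrow> 'p \<Rightarrow> 'l list \<Rightarrow> ('p, 'l, 'v) msg
     \<Rightarrow> ('p, 'l, 'v) acceptor_state \<Rightarrow> ('p, 'l, 'v) acceptor_state" where
  "receive G p ls m s =
     (if is_1a m then receive_1a G p ls m s
      else if is_1b m then receive_1b G p ls m s
      else receive_2a m s)"

section \<open>Executions\<close>

text \<open>The network is asynchronous: \<open>sent\<close> collects all messages created so far, and any of them
  may reach any acceptor at any later time, or never.\<close>

record ('p, 'l, 'v) state =
  local :: "'p \<Rightarrow> ('p, 'l, 'v) acceptor_state"
  sent  :: "('p, 'l, 'v) msg set"

definition init :: "('p, 'l, 'v) state" where
  "init = \<lparr>local = (\<lambda>_. \<lparr>known = {||}, recent = {||}\<rparr>), sent = {}\<rparr>"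

text \<open>Participants other than the safe acceptors in \<open>S\<close> behave arbitrarily, subject to the
  following. They cannot sign for a safe acceptor, and cannot reference a message that does not
  exist yet (\<open>sent\<close> contains a message from its creation on, even if its creator withholds
  it). Ill-formed messages, which everybody ignores, are left out, and so are messages without any
  1a message to determine their ballot. Distinct 1a messages have distinct ballots.\<close>

definition env_step ::
  "('p, 'l) system \<Rightarrow> 'p set \<Rightarrow> ('p, 'l, 'v) state \<Rightarrow> ('p, 'l, 'v) state \<Rightarrow> bool" where
  "env_step G S \<sigma> \<sigma>' \<longleftrightarrow>
     (\<exists>m. Sig m \<in> proposers G - S \<and>
          (is_2a m \<longrightarrow> lrn m \<in> learners G) \<and>
          fset (refs m) \<subseteq> sent \<sigma> \<and>
          (\<exists>y\<in>Tran m. is_1a y) \<and>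
          well_formed G m \<and>
          (is_1a m \<longrightarrow> (\<forall>y\<in>sent \<sigma>. is_1a y \<and> y \<noteq> m \<longrightarrow> ballot y \<noteq> ballot m)) \<and>
          \<sigma>' = \<sigma>\<lparr>sent := insert m (sent \<sigma>)\<rparr>)"

text \<open>A safe acceptor sends the messages it creates and forwards those it receives. Both are
  exactly the messages that enter \<open>known\<close>.\<close>

definition acceptor_step ::
  "('p, 'l) system \<Rightarrow> 'p set \<Rightarrow> ('p, 'l, 'v) state \<Rightarrow> ('p, 'l, 'v) state \<Rightarrow> bool" where
  "acceptor_step G S \<sigma> \<sigma>' \<longleftrightarrow>
     (\<exists>p\<in>S. \<exists>m\<in>sent \<sigma>. \<exists>ls.
          m |\<notin>| known (local \<sigma> p) \<and> refs m |\<subseteq>| known (local \<sigma> p) \<and>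
          distinct ls \<and> set ls = learners G \<and>
          (let s' = receive G p ls m (local \<sigma> p)
           in \<sigma>' = \<lparr>local = (local \<sigma>)(p := s'), sent = sent \<sigma> \<union> fset (known s')\<rparr>))"

text \<open>Executions are infinite sequences; finite ones are represented by stuttering.\<close>

definition execution ::
  "('p, 'l) system \<Rightarrow> 'p set \<Rightarrow> (nat \<Rightarrow> ('p, 'l, 'v) state) \<Rightarrow> bool" where
  "execution G S \<rho> \<longleftrightarrow>
     \<rho> 0 = init \<and>
     (\<forall>n. \<rho> (Suc n) = \<rho> n \<or> env_step G S (\<rho> n) (\<rho> (Suc n)) \<or> acceptor_step G S (\<rho> n) (\<rho> (Suc n)))"

definition messages :: "(nat \<Rightarrow> ('p, 'l, 'v) state) \<Rightarrow> ('p, 'l, 'v) msg set" where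
  "messages \<rho> = (\<Union>n. sent (\<rho> n))"

end

theory Submission
  imports Defs
begin

text \<open>Suppose learner \<open>a\<close> decides \<open>v\<close> in ballot \<open>k\<close>. By induction on the size of a 2a message
  \<open>x\<close> of a learner entangled with \<open>a\<close>, every such \<open>x\<close> with a ballot above \<open>k\<close> has value \<open>v\<close>.
  By validity a safe acceptor signed both a 2a \<open>m\<close> of the deciding quorum and a fresh 1b \<open>n\<close> of
  \<open>q x\<close>. Safe acceptors reference all they sent before, so \<open>m\<close> lies in \<open>Tran n\<close>, and they are
  never caught, so \<open>a\<close> is connected to the learner of \<open>x\<close>. Freshness of \<open>n\<close> thus leaves only the
  possibility that \<open>m\<close> is buried in \<open>n\<close> if the values differ. But then \<open>Tran n\<close> contains a 2a for
  \<open>a\<close> with a ballot above \<open>k\<close> and a value other than \<open>v\<close>, contrary to the induction hypothesis.\<close>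

section \<open>Transitive references\<close>

lemma Tran_refl: "x \<in> Tran x"
  by (subst Tran.simps) simp

lemma Tran_refs: "m |\<in>| refs x \<Longrightarrow> y \<in> Tran m \<Longrightarrow> y \<in> Tran x"
  by (subst Tran.simps) auto

lemma Tran_cases:
  assumes "y \<in> Tran x"
  obtains "y = x" | m where "m |\<in>| refs x" "y \<in> Tran m"
  using assms by (subst (asm) Tran.simps) auto

lemma Tran_trans: "z \<in> Tran y \<Longrightarrow> y \<in> Tran x \<Longrightarrow> z \<in> Tran x"
  by (induction x rule: Tran.induct) (blast elim: Tran_cases intro: Tran_refs)

text \<open>This is acyclicity of the reference graph. It makes \<open>size\<close> a measure for
  the induction on agreement and shows that a newly created message is not yet known.\<close>

lemma Tran_size_less: "y \<in> Tran x \<Longrightarrow> y \<noteq> x \<Longrightarrow> size y < size x"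
proof (induction x rule: Tran.induct)
  case (1 x)
  from \<open>y \<in> Tran x\<close> show ?case
  proof (cases rule: Tran_cases)
    case (2 m)
    then show ?thesis using "1.IH"[of m] size_refs[of m x] by (cases "y = m") auto
  qed (use 1 in auto)
qed

lemma finite_Tran: "finite (Tran x)"
  by (induction x rule: Tran.induct) (subst Tran.simps, simp)

lemma Tran_closed:
  assumes "\<forall>x\<in>M. fset (refs x) \<subseteq> M" and "x \<in> M" and "y \<in> Tran x"
  shows "y \<in> M"
  using assms(2,3)
  by (induction x rule: Tran.induct) (use assms(1) in \<open>blast elim: Tran_cases\<close>)

lemma
  assumes "\<exists>y\<in>Tran x. is_1a y"
  shows Get1a_in_Tran: "Get1a x \<in> Tran x"
    and is_1a_Get1a: "is_1a (Get1a x)"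
    and ballot_le_bal: "y \<in> Tran x \<Longrightarrow> is_1a y \<Longrightarrow> ballot y \<le> bal x"
proof -
  let ?P = "\<lambda>m. m \<in> Tran x \<and> is_1a m"
  obtain k where "?P k" using assms by blast
  \<comment> \<open>Ballots in the finite set \<open>Tran x\<close> are bounded, so the
    \<open>ARG_MAX\<close> in \<open>Get1a\<close> is attained.\<close>
  moreover have "\<forall>y. ?P y \<longrightarrow> ballot y < Suc (Max (ballot ` Tran x))"
    using finite_Tran[of x] by (auto simp: less_Suc_eq_le)
  ultimately have *: "?P (Get1a x) \<and> (\<forall>y. ?P y \<longrightarrow> ballot y \<le> ballot (Get1a x))"
    unfolding Get1a_def by (rule arg_max_nat_lemma)
  show "Get1a x \<in> Tran x" and "is_1a (Get1a x)" using * by auto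
  show "y \<in> Tran x \<Longrightarrow> is_1a y \<Longrightarrow> ballot y \<le> bal x" using * by (auto simp: bal_def)
qed

lemma bal_mono:
  assumes "y \<in> Tran x" and "\<exists>w\<in>Tran y. is_1a w"
  shows "bal y \<le> bal x"
proof -
  have "Get1a y \<in> Tran x" using Get1a_in_Tran Tran_trans assms by blast
  moreover have "is_1a (Get1a y)" using is_1a_Get1a assms(2) by blast
  ultimately show ?thesis using ballot_le_bal[of x "Get1a y"] by (auto simp: bal_def)
qed

section \<open>Agreement on a coherent set of messages\<close>

text \<open>Separates agreement from the dynamics of executions. Well-formedness is asked of 2a
  messages because these are what safe acceptors test before creating them.\<close>

definition coherent :: "('p, 'l) system \<Rightarrow> ('p, 'l, 'v) msg set \<Rightarrow> bool" where
  "coherent G M \<longleftrightarrow>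
     (\<forall>x\<in>M. fset (refs x) \<subseteq> M \<and> (\<exists>y\<in>Tran x. is_1a y) \<and> (is_2a x \<longrightarrow> well_formed G x)) \<and>
     (\<forall>x\<in>M. \<forall>y\<in>M. is_1a x \<and> is_1a y \<and> ballot x = ballot y \<longrightarrow> x = y)"

text \<open>Comparability serves twice: such a signer is never caught, and once ballots exclude one
  direction of reference, the other must hold.\<close>

definition consistent_signer :: "('p, 'l, 'v) msg set \<Rightarrow> 'p \<Rightarrow> bool" where
  "consistent_signer M p \<longleftrightarrow>
     (\<forall>x\<in>M. \<forall>y\<in>M. Sig x = p \<and> Sig y = p \<longrightarrow> x \<in> Tran y \<or> y \<in> Tran x)"

lemma coherent_Tran: "coherent G M \<Longrightarrow> x \<in> M \<Longrightarrow> y \<in> Tran x \<Longrightarrow> y \<in> M"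
  using Tran_closed[of M x y] by (auto simp: coherent_def)

lemma coherent_has_1a: "coherent G M \<Longrightarrow> x \<in> M \<Longrightarrow> \<exists>y\<in>Tran x. is_1a y"
  by (simp add: coherent_def)

lemma coherent_val_eq:
  assumes "coherent G M" and "x \<in> M" and "y \<in> M" and "bal x = bal y"
  shows "val x = val y"
proof -
  have "Get1a z \<in> M" "is_1a (Get1a z)" if "z \<in> M" for z
    using that assms(1) by (meson Get1a_in_Tran is_1a_Get1a coherent_Tran coherent_has_1a)+
  then have "Get1a x = Get1a y"
    using assms unfolding coherent_def bal_def by blast
  then show ?thesis by (simp add: val_def)
qed

text \<open>Condensation along the path \<open>a\<close>, \<open>b\<close>, \<open>a\<close>. It
  lets validity apply to two quorums of the same learner.\<close>

lemma Entangled_self: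
  assumes "learner_graph G" "condensed G" "a \<in> learners G" "b \<in> learners G" "Entangled G S a b"
  shows "Entangled G S a a"
proof -
  have "S \<in> safe_sets G a b \<inter> safe_sets G b a"
    using assms by (auto simp: Entangled_def learner_graph_def)
  then show ?thesis using assms unfolding Entangled_def condensed_def by blast
qed

lemma Entangled_sym:
  "learner_graph G \<Longrightarrow> a \<in> learners G \<Longrightarrow> b \<in> learners G \<Longrightarrow> Entangled G S a b
    \<Longrightarrow> Entangled G S b a"
  by (auto simp: Entangled_def learner_graph_def)

lemma valid_common_signer:
  assumes "valid G" "a \<in> learners G" "b \<in> learners G" "Entangled G S a b"
    and "Sig ` X \<in> quorums G a" "Sig ` Y \<in> quorums G b"
  obtains x y where "x \<in> X" "y \<in> Y" "Sig x \<in> S" "Sig y = Sig x"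
proof -
  have "Sig ` X \<inter> Sig ` Y \<inter> S \<noteq> {}"
    using assms unfolding valid_def Entangled_def by blast
  then obtain r where "r \<in> Sig ` X" "r \<in> Sig ` Y" and "r \<in> S" by blast
  moreover from this obtain x y where "x \<in> X" "r = Sig x" "y \<in> Y" "r = Sig y" by blast
  ultimately show thesis using that[of x y] by simp
qed

lemma consistent_signer_not_caught:
  assumes "coherent G M" and "x \<in> M" and "consistent_signer M p"
  shows "p \<notin> Caught x"
proof
  assume "p \<in> Caught x"
  then obtain m m' where "m \<in> Tran x" "m' \<in> Tran x" "Sig m = p" "Sig m' = p"
    "m \<notin> Tran m'" "m' \<notin> Tran m"
    unfolding Caught_def by auto
  then show False
    using assms(3) coherent_Tran[OF assms(1,2)] unfolding consistent_signer_def by blast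
qed

lemma decision_persists:
  assumes "learner_graph G" "condensed G" "valid G"
    and coh: "coherent G M" and S: "\<forall>p\<in>S. consistent_signer M p"
    and a: "a \<in> learners G" and X: "X \<subseteq> M" "Decision G a X" "y \<in> X"
  shows "x \<in> M \<Longrightarrow> is_2a x \<Longrightarrow> lrn x \<in> learners G \<Longrightarrow> Entangled G S a (lrn x)
    \<Longrightarrow> bal y < bal x \<Longrightarrow> val x = val y"
proof (induction "size x" arbitrary: x rule: less_induct)
  case less
  let ?b = "lrn x"
  have "Sig ` X \<in> quorums G a" using X unfolding Decision_def by blast
  moreover have "Sig ` q G x \<in> quorums G ?b"
    using coh less.prems by (simp add: coherent_def well_formed_def)
  ultimately obtain m n where m: "m \<in> X" and n: "n \<in> q G x"
    and sig: "Sig m \<in> S" "Sig n = Sig m"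
    by (rule valid_common_signer[OF assms(3) a less.prems(3,4)])
  have m2: "is_2a m" "lrn m = a" "bal m = bal y" and mM: "m \<in> M"
    using X m unfolding Decision_def by blast+
  have vm: "val m = val y" using coherent_val_eq[OF coh] mM X m2 by blast
  have n1: "n \<in> Tran x" "is_1b n" "fresh G ?b n" "bal n = bal x"
    using n by (auto simp: q_def)
  have nM: "n \<in> M" using coherent_Tran coh less.prems n1 by blast
  have vn: "val n = val x" using coherent_val_eq coh nM less.prems n1 by blast
  \<comment> \<open>A message has at least the ballot of anything it references, but
    \<open>bal n = bal x\<close> exceeds \<open>bal m = bal y\<close>.\<close>
  have "n \<notin> Tran m"
    using bal_mono[of n m] coherent_has_1a[OF coh nM] n1 m2 less.prems by linarith
  then have mn: "m \<in> Tran n"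
    using S sig mM nM unfolding consistent_signer_def by metis
  have "S \<inter> Caught n = {}"
    using consistent_signer_not_caught[OF coh nM] S by blast
  \<comment> \<open>The safe set avoiding \<open>Caught n\<close> is \<open>S\<close>
    itself.\<close>
  then have con: "a \<in> Con G ?b n"
    using Entangled_sym[OF assms(1) a less.prems(3,4)] a by (auto simp: Con_def Entangled_def)
  show ?case
  proof (rule ccontr)
    assume ne: "val x \<noteq> val y"
    then have "m \<notin> Con2as G ?b n" using n1 vn vm by (auto simp: fresh_def)
    then have "Buried G m n" using mn m2 sig con by (auto simp: Con2as_def)
    moreover define B where "B = {w \<in> Tran n. \<exists>z. is_2a z \<and> {m, z} \<subseteq> Tran w \<and>
      val z \<noteq> val m \<and> bal z > bal m \<and> lrn z = lrn m}"
    ultimately have B: "Sig ` B \<in> quorums G a"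
      using m2 unfolding Buried_def B_def by (simp add: image_Collect)
    have aa: "Entangled G S a a" using Entangled_self[OF assms(1,2) a less.prems(3,4)] .
    \<comment> \<open>Validity with the burying quorum on both sides shows that it is
      nonempty.\<close>
    obtain w where "w \<in> B"
      using valid_common_signer[OF assms(3) a a aa B B] by blast
    then obtain z where z: "is_2a z" "z \<in> Tran n" "val z \<noteq> val y" "bal z > bal y" "lrn z = a"
      using m2 vm Tran_trans unfolding B_def by fastforce
    have "n \<noteq> x" using n1 less.prems by (cases x) auto
    then have "size z < size x"
      using Tran_size_less[OF n1(1)] Tran_size_less[OF z(2)] by (cases "z = n") auto
    moreover have "z \<in> M" using coherent_Tran[OF coh nM z(2)] .
    ultimately have "val z = val y" using less.hyps z a aa by blast
    then show False using z by blast
  qed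
qed

text \<open>A ballot determines its 1a message and hence the value. If the ballots differ, the
  decision with the lower one persists up to the higher; symmetry of entanglement covers both
  orders.\<close>

lemma coherent_agreement:
  assumes "learner_graph G" "condensed G" "valid G"
    and coh: "coherent G M" and S: "\<forall>p\<in>S. consistent_signer M p"
    and ab: "a \<in> learners G" "b \<in> learners G" "Entangled G S a b"
    and X: "X \<subseteq> M" "Decision G a X" and Y: "Y \<subseteq> M" "Decision G b Y"
    and xy: "x \<in> X" "y \<in> Y"
  shows "val x = val y"
proof -
  have x: "is_2a x" "lrn x = a" "x \<in> M" using X xy unfolding Decision_def by blast+
  have y: "is_2a y" "lrn y = b" "y \<in> M" using Y xy unfolding Decision_def by blast+
  note persists = decision_persists[OF assms(1-3) coh S]
  consider "bal x = bal y" | "bal x < bal y" | "bal y < bal x" by linarith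
  then show ?thesis
  proof cases
    case 1
    then show ?thesis using coherent_val_eq coh x y by blast
  next
    case 2
    then show ?thesis using persists[OF ab(1) X xy(1), of y] y ab by simp
  next
    case 3
    then show ?thesis
      using persists[OF ab(2) Y xy(2), of x] x ab Entangled_sym[OF assms(1) ab] by simp
  qed
qed

section \<open>Invariants of executions\<close>

text \<open>Invariant of the local state of acceptor \<open>p\<close>, where \<open>M\<close> is the set of messages sent before the
  current step. Since \<open>recent\<close> transitively references everything in \<open>known\<close>, so does each
  message that \<open>p\<close> creates.\<close>

definition acceptor_inv ::
  "('p, 'l) system \<Rightarrow> ('p, 'l, 'v) msg set \<Rightarrow> 'p \<Rightarrow> ('p, 'l, 'v) acceptor_state \<Rightarrow> bool" where
  "acceptor_inv G M p s \<longleftrightarrow>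
     recent s |\<subseteq>| known s \<and>
     (\<forall>x\<in>fset (known s). refs x |\<subseteq>| known s \<and> (\<exists>y\<in>Tran x. is_1a y) \<and>
        (\<exists>r\<in>fset (recent s). x \<in> Tran r) \<and>
        (x \<in> M \<or> Sig x = p \<and> \<not> is_1a x \<and> (is_2a x \<longrightarrow> well_formed G x))) \<and>
     consistent_signer (fset (known s)) p"

lemma acceptor_inv_mono: "acceptor_inv G M p s \<Longrightarrow> M \<subseteq> M' \<Longrightarrow> acceptor_inv G M' p s"
  unfolding acceptor_inv_def by blast

lemma acceptor_inv_add_msg:
  assumes "acceptor_inv G M p s" and "m \<in> M" and "Sig m \<noteq> p" and "refs m |\<subseteq>| known s"
    and "\<exists>y\<in>Tran m. is_1a y"
  shows "acceptor_inv G M p (add_msg m s)"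
  using assms Tran_refl[of m]
  unfolding acceptor_inv_def consistent_signer_def add_msg_def by auto

text \<open>Referencing \<open>recent\<close> makes \<open>z\<close> reference everything known, so
  \<open>z\<close> is comparable with all earlier messages of \<open>p\<close> and alone suffices as
  the new \<open>recent\<close>. Were \<open>z\<close> already known, it would lie below one of its
  own references.\<close>

lemma acceptor_inv_create:
  assumes inv: "acceptor_inv G M p s" and "Sig z = p" and refs: "refs z = recent s"
    and "recent s \<noteq> {||}" and "\<not> is_1a z" and "is_2a z \<longrightarrow> well_formed G z"
  shows "acceptor_inv G M p (add_msg z (s\<lparr>recent := {||}\<rparr>))" and "z |\<notin>| known s"
proof -
  have ref: "x \<in> Tran z" if "x |\<in>| known s" for x
    using inv that refs Tran_refs[of _ z x] unfolding acceptor_inv_def by blast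
  obtain r where r: "r |\<in>| recent s" using assms(4) by blast
  then have "\<exists>y\<in>Tran r. is_1a y" using inv unfolding acceptor_inv_def by blast
  then have "\<exists>y\<in>Tran z. is_1a y" using Tran_refs[of r z] refs r by auto
  then show "acceptor_inv G M p (add_msg z (s\<lparr>recent := {||}\<rparr>))"
    using assms ref Tran_refl[of z]
    unfolding acceptor_inv_def consistent_signer_def add_msg_def by auto
  show "z |\<notin>| known s"
  proof
    assume "z |\<in>| known s"
    then obtain r where r: "r |\<in>| refs z" "z \<in> Tran r"
      using inv refs unfolding acceptor_inv_def by force
    then have "size z \<le> size r" using Tran_size_less[of z r] by (cases "z = r") auto
    then show False using size_refs[OF r(1)] by simp
  qed
qed

section \<open>Message handling by a safe acceptor\<close>

lemma form_2a_inv: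
  assumes "acceptor_inv G M p s"
  shows "acceptor_inv G M p (form_2a G p l s) \<and> known s |\<subseteq>| known (form_2a G p l s)"
proof (cases "well_formed G (M2a p (recent s) l)")
  case True
  let ?z = "M2a p (recent s) l"
  \<comment> \<open>Well-formedness puts the signer of \<open>?z\<close> among those of
    \<open>q G ?z\<close>. The resulting 1b differs from the 2a \<open>?z\<close>, so it is reached
    through \<open>recent s\<close>.\<close>
  obtain m where "m \<in> Tran ?z" "is_1b m"
    using True by (auto simp: well_formed_def q_def)
  then have "recent s \<noteq> {||}" by (auto elim: Tran_cases)
  then have "acceptor_inv G M p (add_msg ?z (s\<lparr>recent := {||}\<rparr>))" "?z |\<notin>| known s"
    using acceptor_inv_create[OF assms, of ?z] True by auto
  then show ?thesis
    using True by (auto simp: form_2a_def receive_2a_def add_msg_def Let_def)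
qed (use assms in \<open>simp add: form_2a_def\<close>)

lemma fold_form_2a_inv:
  "acceptor_inv G M p s \<Longrightarrow>
    acceptor_inv G M p (fold (form_2a G p) ls s) \<and> known s |\<subseteq>| known (fold (form_2a G p) ls s)"
proof (induction ls arbitrary: s)
  case (Cons l ls)
  then show ?case using form_2a_inv[OF Cons.prems, of l] by fastforce
qed simp

text \<open>The invariant is assumed after adding \<open>m\<close>, since for a 1b that
  \<open>p\<close> creates itself it fails before: \<open>recent\<close> has just been
  emptied.\<close>

lemma receive_1b_inv:
  assumes "acceptor_inv G M p (add_msg m s)"
  shows "m |\<notin>| known s \<Longrightarrow> acceptor_inv G M p (receive_1b G p ls m s)"
    and "known s |\<subseteq>| known (receive_1b G p ls m s)"
  using fold_form_2a_inv[OF assms, of ls] assms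
  by (auto simp: receive_1b_def Let_def add_msg_def)

lemma receive_inv:
  assumes inv: "acceptor_inv G M p s" and m: "m \<in> M" "Sig m \<noteq> p" "refs m |\<subseteq>| known s"
    "\<exists>y\<in>Tran m. is_1a y" "m |\<notin>| known s"
  shows "acceptor_inv G M p (receive G p ls m s)" and "known s |\<subseteq>| known (receive G p ls m s)"
proof -
  let ?s = "add_msg m s"
  let ?z = "M1b p (recent ?s)"
  have add: "acceptor_inv G M p ?s" using acceptor_inv_add_msg[OF inv m(1-4)] .
  have "recent ?s \<noteq> {||}" by (simp add: add_msg_def)
  then have z: "acceptor_inv G M p (add_msg ?z (?s\<lparr>recent := {||}\<rparr>))" "?z |\<notin>| known ?s"
    using acceptor_inv_create[OF add, of ?z] by auto
  \<comment> \<open>\<open>1\<close> treats the 1b created in reply to a 1a, \<open>2\<close> a 1b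
    that was received.\<close>
  note 1 = receive_1b_inv[OF z(1), of ls] and 2 = receive_1b_inv[OF add, of ls]
  show "acceptor_inv G M p (receive G p ls m s)"
    using add m(5) z(2) 1 2
    by (auto simp: receive_def receive_1a_def receive_2a_def Let_def)
  have "known s |\<subseteq>| known ?s" by (auto simp: add_msg_def)
  then show "known s |\<subseteq>| known (receive G p ls m s)"
    using 1(2) 2(2) by (auto simp: receive_def receive_1a_def receive_2a_def Let_def)
qed

text \<open>The last clause expresses unforgeability; it extends \<open>consistent_signer\<close>
  from \<open>known\<close> to all of \<open>sent\<close>.\<close>

definition state_inv :: "('p, 'l) system \<Rightarrow> 'p set \<Rightarrow> ('p, 'l, 'v) state \<Rightarrow> bool" where
  "state_inv G S \<sigma> \<longleftrightarrow>
     coherent G (sent \<sigma>) \<and>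
     (\<forall>p\<in>S. acceptor_inv G (sent \<sigma>) p (local \<sigma> p) \<and> fset (known (local \<sigma> p)) \<subseteq> sent \<sigma> \<and>
        (\<forall>x\<in>sent \<sigma>. Sig x = p \<longrightarrow> x |\<in>| known (local \<sigma> p)))"

section \<open>Preservation of the global invariant\<close>

lemma state_inv_init: "state_inv G S init"
  by (auto simp: state_inv_def coherent_def acceptor_inv_def consistent_signer_def init_def)

lemma state_inv_env_step:
  assumes inv: "state_inv G S \<sigma>" and "env_step G S \<sigma> \<sigma>'"
  shows "state_inv G S \<sigma>'"
proof -
  obtain m where m: "Sig m \<notin> S" "fset (refs m) \<subseteq> sent \<sigma>" "\<exists>y\<in>Tran m. is_1a y"
    "well_formed G m" "is_1a m \<longrightarrow> (\<forall>y\<in>sent \<sigma>. is_1a y \<and> y \<noteq> m \<longrightarrow> ballot y \<noteq> ballot m)"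
    and \<sigma>': "\<sigma>' = \<sigma>\<lparr>sent := insert m (sent \<sigma>)\<rparr>"
    using assms(2) unfolding env_step_def by auto
  have "coherent G (insert m (sent \<sigma>))"
    using inv m unfolding state_inv_def coherent_def
    by auto
  moreover have "acceptor_inv G (insert m (sent \<sigma>)) p (local \<sigma> p)" if "p \<in> S" for p
    using inv that acceptor_inv_mono[of G "sent \<sigma>"] unfolding state_inv_def by blast
  ultimately show ?thesis
    using inv m(1) unfolding state_inv_def \<sigma>' by fastforce
qed

lemma state_inv_acceptor_step:
  assumes inv: "state_inv G S \<sigma>" and "acceptor_step G S \<sigma> \<sigma>'"
  shows "state_inv G S \<sigma>'"
proof -
  obtain p m ls where p: "p \<in> S" and m: "m \<in> sent \<sigma>" "m |\<notin>| known (local \<sigma> p)"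
    "refs m |\<subseteq>| known (local \<sigma> p)"
    and \<sigma>': "\<sigma>' = \<lparr>local = (local \<sigma>)(p := receive G p ls m (local \<sigma> p)),
      sent = sent \<sigma> \<union> fset (known (receive G p ls m (local \<sigma> p)))\<rparr>"
    using assms(2) unfolding acceptor_step_def Let_def by blast
  let ?s = "receive G p ls m (local \<sigma> p)"
  let ?M = "sent \<sigma> \<union> fset (known ?s)"
  have coh: "coherent G (sent \<sigma>)" and loc: "acceptor_inv G (sent \<sigma>) p (local \<sigma> p)"
    using inv p by (auto simp: state_inv_def)
  \<comment> \<open>\<open>p\<close> knows all its own messages, but not \<open>m\<close>.\<close>
  have "Sig m \<noteq> p" using inv p m by (auto simp: state_inv_def)
  then have s: "acceptor_inv G (sent \<sigma>) p ?s" "known (local \<sigma> p) |\<subseteq>| known ?s"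
    using receive_inv[OF loc] m coherent_has_1a[OF coh m(1)] by auto
  have new: "Sig x = p \<and> \<not> is_1a x \<and> (is_2a x \<longrightarrow> well_formed G x)"
    if "x |\<in>| known ?s" "x \<notin> sent \<sigma>" for x
    using s(1) that unfolding acceptor_inv_def by blast
  have "fset (refs x) \<subseteq> ?M \<and> (\<exists>y\<in>Tran x. is_1a y) \<and> (is_2a x \<longrightarrow> well_formed G x)"
    if "x \<in> ?M" for x
  proof (cases "x \<in> sent \<sigma>")
    case True
    then show ?thesis using coh unfolding coherent_def by blast
  next
    case False
    then have "x |\<in>| known ?s" using that by simp
    then show ?thesis using s(1) new False unfolding acceptor_inv_def less_eq_fset.rep_eq by blast
  qed
  moreover have "x = y" if "x \<in> ?M" "y \<in> ?M" "is_1a x" "is_1a y" "ballot x = ballot y" for x y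
  proof -
    \<comment> \<open>Safe acceptors create no 1a messages.\<close>
    have "x \<in> sent \<sigma>" "y \<in> sent \<sigma>" using that new by auto
    then show ?thesis using coh that unfolding coherent_def by blast
  qed
  ultimately have "coherent G ?M" unfolding coherent_def by blast
  moreover have "acceptor_inv G ?M r (local \<sigma>' r) \<and> fset (known (local \<sigma>' r)) \<subseteq> ?M \<and>
    (\<forall>x\<in>?M. Sig x = r \<longrightarrow> x |\<in>| known (local \<sigma>' r))" if "r \<in> S" for r
  proof (cases "r = p")
    case True
    have "x |\<in>| known ?s" if "x \<in> ?M" "Sig x = p" for x
      using that inv p s(2) by (auto simp: state_inv_def)
    then show ?thesis
      using True acceptor_inv_mono[OF s(1), of ?M] by (auto simp: \<sigma>')
  next
    case False
    have r: "acceptor_inv G (sent \<sigma>) r (local \<sigma> r)" "fset (known (local \<sigma> r)) \<subseteq> sent \<sigma>"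
      "\<forall>x\<in>sent \<sigma>. Sig x = r \<longrightarrow> x |\<in>| known (local \<sigma> r)"
      using inv \<open>r \<in> S\<close> unfolding state_inv_def by blast+
    have "x |\<in>| known (local \<sigma> r)" if "x \<in> ?M" "Sig x = r" for x
      using that r(3) new[of x] False by blast
    then show ?thesis
      using False r(2) acceptor_inv_mono[OF r(1), of ?M] by (auto simp: \<sigma>')
  qed
  ultimately show ?thesis unfolding state_inv_def by (simp add: \<sigma>')
qed

section \<open>From single states to whole executions\<close>

lemma execution_state_inv:
  assumes "execution G S \<rho>"
  shows "state_inv G S (\<rho> n)"
proof (induction n)
  case 0
  then show ?case using assms state_inv_init by (simp add: execution_def)
next
  case (Suc n)
  then show ?case
    using assms state_inv_env_step state_inv_acceptor_step unfolding execution_def by metis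
qed

lemma execution_sent_mono:
  assumes "execution G S \<rho>" and "i \<le> j"
  shows "sent (\<rho> i) \<subseteq> sent (\<rho> j)"
proof -
  have "sent (\<rho> n) \<subseteq> sent (\<rho> (Suc n))" for n
  proof -
    consider "\<rho> (Suc n) = \<rho> n" | "env_step G S (\<rho> n) (\<rho> (Suc n))"
      | "acceptor_step G S (\<rho> n) (\<rho> (Suc n))"
      using assms(1) unfolding execution_def by blast
    then show ?thesis
      by cases (auto simp: env_step_def acceptor_step_def Let_def)
  qed
  then show ?thesis using lift_Suc_mono_le[of "\<lambda>n. sent (\<rho> n)"] assms(2) by blast
qed

text \<open>Each condition involves at most two messages of the execution. As \<open>sent\<close>
  only grows, they occur together in some state, where the invariant applies.\<close>

lemma execution_messages:
  assumes "execution G S \<rho>"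
  shows "coherent G (messages \<rho>)" and "\<forall>p\<in>S. consistent_signer (messages \<rho>) p"
proof -
  have two: "\<exists>n. x \<in> sent (\<rho> n) \<and> y \<in> sent (\<rho> n)" if "x \<in> messages \<rho>" "y \<in> messages \<rho>" for x y
  proof -
    obtain i j where "x \<in> sent (\<rho> i)" "y \<in> sent (\<rho> j)" using \<open>x \<in> messages \<rho>\<close> \<open>y \<in> messages \<rho>\<close> by (auto simp: messages_def)
    then show ?thesis
      using execution_sent_mono[OF assms, of i "max i j"] execution_sent_mono[OF assms, of j "max i j"]
      by auto
  qed
  have coh: "coherent G (sent (\<rho> n))" for n
    using execution_state_inv[OF assms, of n] by (simp add: state_inv_def)
  have "fset (refs x) \<subseteq> messages \<rho> \<and> (\<exists>y\<in>Tran x. is_1a y) \<and> (is_2a x \<longrightarrow> well_formed G x)"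
    if "x \<in> messages \<rho>" for x
    using that coh unfolding messages_def coherent_def by blast
  moreover have "x = y" if "x \<in> messages \<rho>" "y \<in> messages \<rho>" "is_1a x" "is_1a y"
    "ballot x = ballot y" for x y
    using two[OF that(1,2)] that(3-5) coh unfolding coherent_def by blast
  ultimately show "coherent G (messages \<rho>)" unfolding coherent_def by blast
  have "consistent_signer (sent (\<rho> n)) p" if "p \<in> S" for n p
    using execution_state_inv[OF assms, of n] that
    unfolding state_inv_def acceptor_inv_def consistent_signer_def by blast
  then show "\<forall>p\<in>S. consistent_signer (messages \<rho>) p"
    using two unfolding consistent_signer_def by meson
qed

theorem theorem40:
  fixes G :: "('p, 'l) system"
    and S :: "'p set"
    and \<rho> :: "nat \<Rightarrow> ('p, 'l, 'v) state"
    and a b :: 'l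
    and q\<^sub>a q\<^sub>b :: "('p, 'l, 'v) msg set"
  assumes "learner_graph G" and "condensed G" and "valid G"
    and "S \<subseteq> acceptors G"
    and "execution G S \<rho>"
    and "a \<in> learners G" and "b \<in> learners G"
    and "q\<^sub>a \<subseteq> messages \<rho>" and "q\<^sub>b \<subseteq> messages \<rho>"
    and "Entangled G S a b"
    and "Decision G a q\<^sub>a" and "Decision G b q\<^sub>b"
  shows "common_val q\<^sub>a = common_val q\<^sub>b"
proof -
  note coh = execution_messages[OF assms(5)]
  note agree = coherent_agreement[OF assms(1-3) coh assms(6,7,10) assms(8,11) assms(9,12)]
  have "Sig ` q\<^sub>a \<in> quorums G a" "Sig ` q\<^sub>b \<in> quorums G b"
    using assms unfolding Decision_def by blast+
  then obtain x y where xy: "x \<in> q\<^sub>a" "y \<in> q\<^sub>b"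
    by (rule valid_common_signer[OF assms(3,6,7,10)])
  \<comment> \<open>Equal predicates give equal \<open>THE\<close> terms. The elements
    \<open>x\<close> and \<open>y\<close> exclude an empty decision set, for which every
    \<open>v\<close> would qualify.\<close>
  have "(\<forall>z\<in>q\<^sub>a. val z = v) \<longleftrightarrow> (\<forall>z\<in>q\<^sub>b. val z = v)" for v
    using agree xy by metis
  then show ?thesis by (simp add: common_val_def)
qed

end
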